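(* Let $B$ be a complete Boolean algebra. For every $a\in B$ there exists an $L_B$-sentence $\sigma_a$ such that $\llbracket\sigma_a\rrbracket_B=a$.
   Context: For a complete Boolean algebra $B$ (bottom $0$, top $1$, complement $a^\ast$, $a\to b:=a^\ast\vee b$), define by transfinite recursion $V^{(B)}_\alpha=\{x: x$ is a function, $\mathrm{ran}(x)\subseteq B$, and $\mathrm{dom}(x)\subseteq V^{(B)}_\xi$ for some $\xi<\alpha\}$ and $V^{(B)}=\bigcup_\alpha V^{(B)}_\alpha$. $L_B$ is the first-order language of set theory expanded by a constant symbol for each element of $V^{(B)}$. The Boolean value $\llbracket\cdot\rrbracket_B$ of $L_B$-sentences is defined recursively by $\llbracket u\in v\rrbracket_B=\bigvee_{x\in\mathrm{dom}(v)}(v(x)\wedge\llbracket x=u\rrbracket_B)$, $\llbracket u=v\rrbracket_B=\bigwedge_{x\in\mathrm{dom}(u)}(u(x)\to\llbracket x\in v\rrbracket_B)\wedge\bigwedge_{y\in\mathrm{dom}(v)}(v(y)\to\llbracket y\in u\rrbracket_B)$, the Boolean operations for the connectives, and meets (resp. joins) over $V^{(B)}$ for $\forall$ (resp. $\exists$). *)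

theory Defs
  imports "HOL-Algebra.Complete_Lattice" "HOL-Library.Multiset"
begin

section \<open>The set-theoretic universe\<close>

text \<open>
  The universe \<open>V\<close> in which \<open>V\<^sup>(\<^sup>B\<^sup>)\<close> is built is a type carrying a membership structure that
  satisfies the axioms of ZFC; \<open>elts x\<close> is the collection of members of \<open>x\<close>. HOL predicates
  and functions on the type play the role of classes, so Separation and Replacement are single
  axioms. Choice is not listed because it follows from Replacement and the choice operator of HOL.
\<close>

class zfc =
  fixes elts :: "'a \<Rightarrow> 'a set"
  assumes extensionality: "elts x = elts y \<Longrightarrow> x = y"
    and foundation: "wf {(x, y). x \<in> elts y}"
    and pairing: "\<exists>z. elts z = {x, y}"
    and union: "\<exists>z. elts z = (\<Union>y\<in>elts x. elts y)"
    and powerset: "\<exists>z. elts z = {y. elts y \<subseteq> elts x}"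
    and infinity: "\<exists>z. (\<exists>x\<in>elts z. elts x = {}) \<and>
                      (\<forall>x\<in>elts z. \<exists>y\<in>elts z. elts y = insert x (elts x))"
    and separation: "\<exists>z. elts z = {y \<in> elts x. P y}"
    and replacement: "\<exists>z. elts z = f ` elts x"

text \<open>\<open>set_of A\<close> is meaningful only when the collection \<open>A\<close> is (the extension of) a set.\<close>

definition set_of :: "'v::zfc set \<Rightarrow> 'v" where
  "set_of A = (THE x. elts x = A)"

definition opair :: "'v::zfc \<Rightarrow> 'v \<Rightarrow> 'v" where
  "opair x y = set_of {set_of {x, x}, set_of {x, y}}"

definition is_function :: "'v::zfc \<Rightarrow> bool" where
  "is_function f \<longleftrightarrow> (\<forall>p\<in>elts f. \<exists>x y. p = opair x y) \<and>
     (\<forall>x y z. opair x y \<in> elts f \<longrightarrow> opair x z \<in> elts f \<longrightarrow> y = z)"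

definition fdom :: "'v::zfc \<Rightarrow> 'v set" where
  "fdom f = {x. \<exists>y. opair x y \<in> elts f}"

definition fran :: "'v::zfc \<Rightarrow> 'v set" where
  "fran f = {y. \<exists>x. opair x y \<in> elts f}"

definition app :: "'v::zfc \<Rightarrow> 'v \<Rightarrow> 'v" where
  "app f x = (THE y. opair x y \<in> elts f)"

text \<open>Von Neumann ordinals; \<open>\<xi> < \<alpha>\<close> means \<open>\<xi> \<in> elts \<alpha>\<close>.\<close>

definition transitive_set :: "'v::zfc \<Rightarrow> bool" where
  "transitive_set x \<longleftrightarrow> (\<forall>y\<in>elts x. elts y \<subseteq> elts x)"

definition Ord :: "'v::zfc \<Rightarrow> bool" where
  "Ord \<alpha> \<longleftrightarrow> transitive_set \<alpha> \<and> (\<forall>\<xi>\<in>elts \<alpha>. transitive_set \<xi>)"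


section \<open>Complete Boolean algebras\<close>

text \<open>
  The type class \<open>complete_boolean_algebra\<close> demands complete distributivity, which leaves only
  the atomic algebras. A complete Boolean algebra is a complemented distributive
  lattice that is complete.
\<close>

locale complete_boolean_alg = complete_lattice L for L (structure) +
  assumes meet_join_distrib:
      "\<lbrakk>x \<in> carrier L; y \<in> carrier L; z \<in> carrier L\<rbrakk> \<Longrightarrow> x \<sqinter> (y \<squnion> z) = (x \<sqinter> y) \<squnion> (x \<sqinter> z)"
    and complement_exists:
      "x \<in> carrier L \<Longrightarrow> \<exists>y\<in>carrier L. x \<sqinter> y = \<bottom> \<and> x \<squnion> y = \<top>"

definition bcompl :: "('v, 'm) gorder_scheme \<Rightarrow> 'v \<Rightarrow> 'v" where
  "bcompl B a = (THE y. y \<in> carrier B \<and> a \<sqinter>\<^bsub>B\<^esub> y = \<bottom>\<^bsub>B\<^esub> \<and> a \<squnion>\<^bsub>B\<^esub> y = \<top>\<^bsub>B\<^esub>)"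

definition bimp :: "('v, 'm) gorder_scheme \<Rightarrow> 'v \<Rightarrow> 'v \<Rightarrow> 'v" where
  "bimp B a b = bcompl B a \<squnion>\<^bsub>B\<^esub> b"


section \<open>The Boolean-valued universe\<close>

text \<open>
  The hierarchy is given by recursion on membership; only its values at ordinals are used.
\<close>

function VB_level :: "('v::zfc, 'm) gorder_scheme \<Rightarrow> 'v \<Rightarrow> 'v set" where
  "VB_level B \<alpha> =
     {x. is_function x \<and> fran x \<subseteq> carrier B \<and> (\<exists>\<xi>\<in>elts \<alpha>. fdom x \<subseteq> VB_level B \<xi>)}"
  by pat_completeness auto
termination
  by (relation "inv_image {(x, y). x \<in> elts y} snd") (auto intro: foundation)

declare VB_level.simps [simp del]

definition VB :: "('v::zfc, 'm) gorder_scheme \<Rightarrow> 'v set" where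
  "VB B = (\<Union>\<alpha>\<in>{\<alpha>. Ord \<alpha>}. VB_level B \<alpha>)"


section \<open>Boolean values of atomic sentences\<close>

lemma elts_set_of_pair: "elts (set_of {x, y}) = {x, y}"
proof -
  obtain z where "elts z = {x, y}" using pairing by blast
  then show ?thesis
    unfolding set_of_def by (rule theI) (metis \<open>elts z = {x, y}\<close> extensionality)
qed

lemma fdom_trancl: "x \<in> fdom v \<Longrightarrow> (x, v) \<in> {(x, y). x \<in> elts y}\<^sup>+"
proof -
  assume "x \<in> fdom v"
  then obtain y where y: "opair x y \<in> elts v" unfolding fdom_def by blast
  have "x \<in> elts (set_of {x, x})" "set_of {x, x} \<in> elts (opair x y)"
    using elts_set_of_pair[of x x] by (simp_all add: opair_def elts_set_of_pair)
  then have "(x, set_of {x, x}) \<in> {(x, y). x \<in> elts y}\<^sup>+"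
    "(set_of {x, x}, opair x y) \<in> {(x, y). x \<in> elts y}\<^sup>+"
    "(opair x y, v) \<in> {(x, y). x \<in> elts y}\<^sup>+"
    using y by (auto intro!: r_into_trancl)
  then show ?thesis by (blast intro: trancl_trans)
qed

lemma wf_fdom: "wf {(x, v). x \<in> fdom v}"
  by (rule wf_subset[OF wf_trancl[OF foundation]]) (auto intro: fdom_trancl)

text \<open>
  \<open>bmem B u v\<close> and \<open>beq B u v\<close> are the Boolean values of \<open>u \<in> v\<close> and \<open>u = v\<close>. Every recursive
  call replaces one of the two names by an element of its domain.
\<close>

context
  notes image_cong [fundef_cong]
begin

function bmem :: "('v::zfc, 'm) gorder_scheme \<Rightarrow> 'v \<Rightarrow> 'v \<Rightarrow> 'v"
  and beq :: "('v::zfc, 'm) gorder_scheme \<Rightarrow> 'v \<Rightarrow> 'v \<Rightarrow> 'v" where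
  "bmem B u v = \<Squnion>\<^bsub>B\<^esub> ((\<lambda>x. app v x \<sqinter>\<^bsub>B\<^esub> beq B x u) ` fdom v)"
| "beq B u v =
     \<Sqinter>\<^bsub>B\<^esub> ((\<lambda>x. bimp B (app u x) (bmem B x v)) ` fdom u) \<sqinter>\<^bsub>B\<^esub>
     \<Sqinter>\<^bsub>B\<^esub> ((\<lambda>y. bimp B (app v y) (bmem B y u)) ` fdom v)"
  by pat_completeness auto
termination
proof (relation "inv_image (mult {(x, v). x \<in> fdom v})
    (\<lambda>p. case p of Inl (B, u, v) \<Rightarrow> {#u, v#} | Inr (B, u, v) \<Rightarrow> {#u, v#})", goal_cases)
  case 1
  show ?case by (intro wf_inv_image wf_mult wf_fdom)
next
  have step: "({#w, x#}, {#w, v#}) \<in> mult {(x, v). x \<in> fdom v}" if "x \<in> fdom v" for w x v :: "'v::zfc"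
    using one_step_implies_mult[of "{#v#}" "{#x#}" "{(x, v). x \<in> fdom v}" "{#w#}"] that
    by (simp add: add_mset_commute)
  {
    case (2 B u v x)
    then show ?case using step[of x v u] by (simp add: add_mset_commute)
  next
    case (3 B u v x)
    then show ?case using step[of x u v] by (simp add: add_mset_commute)
  next
    case (4 B u v x)
    then show ?case using step[of x v u] by (simp add: add_mset_commute)
  }
qed

end

declare bmem.simps [simp del] beq.simps [simp del]


section \<open>The language and its Boolean-valued semantics\<close>

datatype 'c trm = Var nat | Const 'c

datatype 'c fm =
    Mem "'c trm" "'c trm"
  | Eq "'c trm" "'c trm"
  | Neg "'c fm"
  | And "'c fm" "'c fm"
  | Or "'c fm" "'c fm"
  | Imp "'c fm" "'c fm"
  | All nat "'c fm"
  | Ex nat "'c fm"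

primrec fv_trm :: "'c trm \<Rightarrow> nat set" where
  "fv_trm (Var n) = {n}"
| "fv_trm (Const c) = {}"

primrec fv :: "'c fm \<Rightarrow> nat set" where
  "fv (Mem s t) = fv_trm s \<union> fv_trm t"
| "fv (Eq s t) = fv_trm s \<union> fv_trm t"
| "fv (Neg \<phi>) = fv \<phi>"
| "fv (And \<phi> \<psi>) = fv \<phi> \<union> fv \<psi>"
| "fv (Or \<phi> \<psi>) = fv \<phi> \<union> fv \<psi>"
| "fv (Imp \<phi> \<psi>) = fv \<phi> \<union> fv \<psi>"
| "fv (All n \<phi>) = fv \<phi> - {n}"
| "fv (Ex n \<phi>) = fv \<phi> - {n}"

text \<open>\<open>set_fm \<phi>\<close> is the set of constants occurring in \<open>\<phi>\<close>.\<close>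

definition LB_sentence :: "('v::zfc, 'm) gorder_scheme \<Rightarrow> 'v fm \<Rightarrow> bool" where
  "LB_sentence B \<phi> \<longleftrightarrow> fv \<phi> = {} \<and> set_fm \<phi> \<subseteq> VB B"

primrec subst_trm :: "nat \<Rightarrow> 'c \<Rightarrow> 'c trm \<Rightarrow> 'c trm" where
  "subst_trm n c (Var m) = (if m = n then Const c else Var m)"
| "subst_trm n c (Const d) = Const d"

primrec subst :: "nat \<Rightarrow> 'c \<Rightarrow> 'c fm \<Rightarrow> 'c fm" where
  "subst n c (Mem s t) = Mem (subst_trm n c s) (subst_trm n c t)"
| "subst n c (Eq s t) = Eq (subst_trm n c s) (subst_trm n c t)"
| "subst n c (Neg \<phi>) = Neg (subst n c \<phi>)"
| "subst n c (And \<phi> \<psi>) = And (subst n c \<phi>) (subst n c \<psi>)"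
| "subst n c (Or \<phi> \<psi>) = Or (subst n c \<phi>) (subst n c \<psi>)"
| "subst n c (Imp \<phi> \<psi>) = Imp (subst n c \<phi>) (subst n c \<psi>)"
| "subst n c (All m \<phi>) = All m (if m = n then \<phi> else subst n c \<phi>)"
| "subst n c (Ex m \<phi>) = Ex m (if m = n then \<phi> else subst n c \<phi>)"

primrec fm_depth :: "'c fm \<Rightarrow> nat" where
  "fm_depth (Mem s t) = 0"
| "fm_depth (Eq s t) = 0"
| "fm_depth (Neg \<phi>) = Suc (fm_depth \<phi>)"
| "fm_depth (And \<phi> \<psi>) = Suc (max (fm_depth \<phi>) (fm_depth \<psi>))"
| "fm_depth (Or \<phi> \<psi>) = Suc (max (fm_depth \<phi>) (fm_depth \<psi>))"
| "fm_depth (Imp \<phi> \<psi>) = Suc (max (fm_depth \<phi>) (fm_depth \<psi>))"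
| "fm_depth (All n \<phi>) = Suc (fm_depth \<phi>)"
| "fm_depth (Ex n \<phi>) = Suc (fm_depth \<phi>)"

lemma fm_depth_subst [simp]: "fm_depth (subst n c \<phi>) = fm_depth \<phi>"
  by (induction \<phi>) auto

text \<open>Sentences have no atomic subformula with a variable left when it is evaluated, so the
  last equation is never reached from a sentence.\<close>

function (sequential) bval :: "('v::zfc, 'm) gorder_scheme \<Rightarrow> 'v fm \<Rightarrow> 'v" where
  "bval B (Mem (Const u) (Const v)) = bmem B u v"
| "bval B (Eq (Const u) (Const v)) = beq B u v"
| "bval B (Neg \<phi>) = bcompl B (bval B \<phi>)"
| "bval B (And \<phi> \<psi>) = bval B \<phi> \<sqinter>\<^bsub>B\<^esub> bval B \<psi>"
| "bval B (Or \<phi> \<psi>) = bval B \<phi> \<squnion>\<^bsub>B\<^esub> bval B \<psi>"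
| "bval B (Imp \<phi> \<psi>) = bimp B (bval B \<phi>) (bval B \<psi>)"
| "bval B (All n \<phi>) = \<Sqinter>\<^bsub>B\<^esub> ((\<lambda>u. bval B (subst n u \<phi>)) ` VB B)"
| "bval B (Ex n \<phi>) = \<Squnion>\<^bsub>B\<^esub> ((\<lambda>u. bval B (subst n u \<phi>)) ` VB B)"
| "bval B _ = undefined"
  by pat_completeness auto
termination
  by (relation "measure (\<lambda>(B, \<phi>). fm_depth \<phi>)") auto

end

theory Submission
  imports Defs
begin

text \<open>
  The sentence is \<open>\<emptyset> \<in> {(\<emptyset>, a)}\<close>: both meets in \<open>\<lbrakk>\<emptyset> = \<emptyset>\<rbrakk>\<close> are empty, so its value is
  \<open>a \<sqinter> \<top> = a\<close>.
\<close>

lemma exists_empty: "\<exists>e::'v::zfc. elts e = {}"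
  using separation[where P = "\<lambda>_. False"] by simp

lemma elts_set_of_singleton: "elts (set_of {x}) = {x}"
  using elts_set_of_pair[of x x] by simp

text \<open>\<open>set_of\<close> is a definite description, so it is not injective on arbitrary
  collections; on doubletons the pairing axiom lets \<open>elts\<close> recover the
  argument.\<close>

lemma set_of_pair_eq_iff: "set_of {x, y} = set_of {x', y'} \<longleftrightarrow> {x, y} = {x', y'}"
  by (metis elts_set_of_pair)

text \<open>Injectivity of Kuratowski pairs, by comparing doubletons twice. It determines domain,
  range and value of a one-pair function.\<close>

lemma opair_eq_iff: "opair x y = opair x' y' \<longleftrightarrow> x = x' \<and> y = y'"
  unfolding opair_def set_of_pair_eq_iff doubleton_eq_iff by blast

lemma is_function_singleton: "elts f = {opair x y} \<Longrightarrow> is_function f"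
  by (auto simp: is_function_def opair_eq_iff)

lemma fdom_singleton: "elts f = {opair x y} \<Longrightarrow> fdom f = {x}"
  by (auto simp: fdom_def opair_eq_iff)

lemma fran_singleton: "elts f = {opair x y} \<Longrightarrow> fran f = {y}"
  by (auto simp: fran_def opair_eq_iff)

lemma app_singleton: "elts f = {opair x y} \<Longrightarrow> app f x = y"
  by (simp add: app_def opair_eq_iff)

lemma fdom_empty: "elts e = {} \<Longrightarrow> fdom e = {}"
  by (simp add: fdom_def)

text \<open>With an empty domain, any \<open>\<xi> \<in> elts \<alpha>\<close> is a witness; level 0
  has no witness and is empty.\<close>

lemma VB_level_empty_name:
  assumes "elts e = {}" "elts \<alpha> \<noteq> {}"
  shows "e \<in> VB_level B \<alpha>"
  using assms by (subst VB_level.simps) (auto simp: is_function_def fdom_def fran_def)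

lemma empty_name_in_VB:
  assumes "elts e = {}"
  shows "e \<in> VB B"
proof -
  \<comment> \<open>The ordinal 1, since \<open>e\<close> is also the ordinal 0.\<close>
  have "Ord (set_of {e})"
    using assms by (simp add: Ord_def transitive_set_def elts_set_of_singleton)
  moreover have "e \<in> VB_level B (set_of {e})"
    using assms by (simp add: VB_level_empty_name elts_set_of_singleton)
  ultimately show ?thesis by (auto simp: VB_def)
qed

lemma singleton_name_in_VB:
  assumes e: "elts e = {}" and v: "elts v = {opair e a}" and a: "a \<in> carrier B"
  shows "v \<in> VB B"
proof -
  \<comment> \<open>The ordinals 1 and 2: the domain \<open>{e}\<close> of \<open>v\<close> lies in
    level 1, so \<open>v\<close> lies in level 2.\<close>
  let ?one = "set_of {e}"
  let ?two = "set_of {e, ?one}"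
  have "Ord ?two"
    using e by (simp add: Ord_def transitive_set_def elts_set_of_pair elts_set_of_singleton)
  moreover have "v \<in> VB_level B ?two"
    using e a is_function_singleton[OF v] fdom_singleton[OF v] fran_singleton[OF v]
    by (subst VB_level.simps) (simp add: elts_set_of_pair elts_set_of_singleton VB_level_empty_name)
  ultimately show ?thesis by (auto simp: VB_def)
qed

lemma (in complete_lattice) inf_empty: "\<Sqinter>{} = \<top>"
  using weak_inf_empty unfolding eq_is_equal .

lemma (in complete_lattice) meet_top: "x \<in> carrier L \<Longrightarrow> x \<sqinter> \<top> = x"
  by (metis le_iff_join top_closed top_higher)

lemma beq_empty_names:
  assumes "complete_lattice B" "elts u = {}" "elts v = {}"
  shows "beq B u v = \<top>\<^bsub>B\<^esub>"
proof -
  interpret complete_lattice B by fact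
  show ?thesis
    using assms by (simp add: beq.simps fdom_empty inf_empty meet_top)
qed

theorem lemma5p2:
  fixes B :: "('v::zfc, 'm) gorder_scheme"
    and a :: 'v
  assumes "complete_boolean_alg B"
    and "\<exists>b. carrier B = elts b"
    and "a \<in> carrier B"
  shows "\<exists>\<sigma>. LB_sentence B \<sigma> \<and> bval B \<sigma> = a"
proof -
  interpret complete_boolean_alg B by fact
  obtain e :: 'v where e: "elts e = {}"
    using exists_empty by blast
  \<comment> \<open>Elements of \<open>B\<close> are themselves sets of the universe, so
    \<open>a\<close> can be the value of a name.\<close>
  define v where "v = set_of {opair e a}"
  have v: "elts v = {opair e a}"
    by (simp add: v_def elts_set_of_singleton)
  \<comment> \<open>The join runs over the single index \<open>e\<close>; as \<open>a\<close> is in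
    the carrier, both the meet with top and the one-element join reduce to \<open>a\<close>.\<close>
  have "bmem B e v = a"
    using assms(3)
    by (simp add: bmem.simps fdom_singleton[OF v] app_singleton[OF v]
        beq_empty_names[OF complete_lattice_axioms e e] meet_top)
  moreover have "LB_sentence B (Mem (Const e) (Const v))"
    using empty_name_in_VB[OF e] singleton_name_in_VB[OF e v assms(3)]
    by (simp add: LB_sentence_def)
  ultimately show ?thesis
    by (intro exI[of _ "Mem (Const e) (Const v)"]) simp
qed

end
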